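(* Let $n,m\ge 1$, let $B_0,B_1,\dots,B_m$ be $n\times n$ unitary matrices, let $\alpha_1,\dots,\alpha_m$ be complex numbers with $|\alpha_1|<|\alpha_2|<\cdots<|\alpha_m|$, and let $$T(\lambda)=-B_0+I\lambda+\frac{B_1}{\lambda-\alpha_1}+\cdots+\frac{B_m}{\lambda-\alpha_m}.$$ Then for any eigenvalue $\lambda_0$ of $T(\lambda)$, $$|\lambda_0|\le\left\{\frac{(2m+1)+(4m+1)^{1/2}}{2}\right\}^{1/2}+|\alpha_m|.$$
   Context: $I$ denotes the $n\times n$ identity matrix. A complex number $\lambda_0$ is an eigenvalue of the rational matrix $T(\lambda)$ if $T(\lambda_0)$ has finite entries and there is a nonzero $v\in\mathbb{C}^n$ with $T(\lambda_0)v=0$. *)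

theory Defs
  imports "HOL-Analysis.Analysis" "HOL-Computational_Algebra.Polynomial_Factorial"
begin

definition conj_transpose :: "complex ^ 'n ^ 'm \<Rightarrow> complex ^ 'm ^ 'n" where
  "conj_transpose A = (\<chi> i j. cnj (A $ j $ i))"

definition unitary_matrix :: "complex ^ 'n ^ 'n \<Rightarrow> bool" where
  "unitary_matrix U \<longleftrightarrow> conj_transpose U ** U = mat 1 \<and> U ** conj_transpose U = mat 1"

(* Rational functions in one variable are elements of the fraction field of complex [X],
   and a rational matrix is a matrix over that field. *)

type_synonym ratfun = "complex poly fract"

definition ratfun_const :: "complex \<Rightarrow> ratfun" where
  "ratfun_const c = to_fract [:c:]"

definition ratfun_var :: ratfun where
  "ratfun_var = to_fract [:0, 1:]"

(* f is finite (has no pole) at z, with value w there: some representation of f as a quotient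
   of polynomials has a denominator that does not vanish at z. The value does not depend on
   the representation. *)

definition ratfun_value :: "ratfun \<Rightarrow> complex \<Rightarrow> complex \<Rightarrow> bool" where
  "ratfun_value f z w \<longleftrightarrow>
     (\<exists>p q. poly q z \<noteq> 0 \<and> f = Fract p q \<and> w = poly p z / poly q z)"

definition ratmat_value :: "ratfun ^ 'n ^ 'm \<Rightarrow> complex \<Rightarrow> complex ^ 'n ^ 'm \<Rightarrow> bool" where
  "ratmat_value T z A \<longleftrightarrow> (\<forall>i j. ratfun_value (T $ i $ j) z (A $ i $ j))"

definition ratmat_eigenvalue :: "ratfun ^ 'n ^ 'n \<Rightarrow> complex \<Rightarrow> bool" where
  "ratmat_eigenvalue T z \<longleftrightarrow> (\<exists>A. ratmat_value T z A \<and> (\<exists>v. v \<noteq> 0 \<and> A *v v = 0))"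

definition T_matrix ::
  "nat \<Rightarrow> (nat \<Rightarrow> complex ^ 'n ^ 'n) \<Rightarrow> (nat \<Rightarrow> complex) \<Rightarrow> ratfun ^ 'n ^ 'n" where
  "T_matrix m B \<alpha> = (\<chi> i k.
     - ratfun_const (B 0 $ i $ k) + mat 1 $ i $ k * ratfun_var
     + (\<Sum>j = 1..m. ratfun_const (B j $ i $ k) / (ratfun_var - ratfun_const (\<alpha> j))))"

end

theory Submission
  imports Defs
begin

text \<open>
  Apply \<open>T(\<lambda>)\<close> at an eigenvalue \<open>\<lambda>\<close> to a null vector \<open>v\<close>:
  \<open>\<lambda> v = B\<^sub>0 v - (\<Sum>j. B\<^sub>j v / (\<lambda> - \<alpha>\<^sub>j))\<close>.
  Unitary matrices preserve the Euclidean norm, so after division by the norm of \<open>v\<close> this gives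
  \<open>|\<lambda>| \<le> 1 + (\<Sum>j. 1 / |\<lambda> - \<alpha>\<^sub>j|)\<close>. If \<open>x = |\<lambda>| - |\<alpha>\<^sub>m|\<close> is not positive there is nothing to prove.
  Otherwise \<open>|\<lambda> - \<alpha>\<^sub>j| \<ge> |\<lambda>| - |\<alpha>\<^sub>j| \<ge> x\<close> for every \<open>j\<close>, whence \<open>x \<le> |\<lambda>| \<le> 1 + m / x\<close>, that is,
  \<open>x\<^sup>2 \<le> x + m\<close>. Hence \<open>x\<close> is at most the positive root \<open>(1 + sqrt (4 m + 1)) / 2\<close>, and the square
  of that root is \<open>((2 m + 1) + sqrt (4 m + 1)) / 2\<close>, the number under the root in the theorem.

  The matrix \<open>T\<close> has entries in a fraction field, so this argument also needs the value of each
  entry at \<open>\<lambda>\<close>. In the case \<open>x > 0\<close> no denominator \<open>\<lambda> - \<alpha>\<^sub>j\<close> vanishes, and the value is obtained by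
  substitution, because evaluation is compatible with the field operations
  (\<open>ratfun_value_add\<close> and its companions) and single-valued (\<open>ratfun_value_unique\<close>).
\<close>

section \<open>Evaluation of rational functions\<close>

lemma ratfun_valueI:
  assumes "poly q z \<noteq> 0"
  shows "ratfun_value (Fract p q) z (poly p z / poly q z)"
  using assms by (auto simp: ratfun_value_def)

lemma ratfun_valueE:
  assumes "ratfun_value f z w"
  obtains p q where "poly q z \<noteq> 0" "q \<noteq> 0" "f = Fract p q" "w = poly p z / poly q z"
  using assms unfolding ratfun_value_def by force

lemma ratfun_value_unique:
  assumes "ratfun_value f z w" "ratfun_value f z w'"
  shows "w = w'"
proof -
  obtain p q where pq: "poly q z \<noteq> 0" "q \<noteq> 0" "f = Fract p q" "w = poly p z / poly q z"
    using assms(1) by (rule ratfun_valueE)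
  obtain r s where rs: "poly s z \<noteq> 0" "s \<noteq> 0" "f = Fract r s" "w' = poly r z / poly s z"
    using assms(2) by (rule ratfun_valueE)
  have "p * s = r * q"
    using pq rs by (simp add: eq_fract)
  hence "poly p z * poly s z = poly r z * poly q z"
    by (metis poly_mult)
  thus ?thesis
    using pq rs by (simp add: frac_eq_eq)
qed

lemma ratfun_value_const: "ratfun_value (ratfun_const c) z c"
  using ratfun_valueI[of 1 z "[:c:]"] by (simp add: ratfun_const_def to_fract_def)

lemma ratfun_value_var: "ratfun_value ratfun_var z z"
  using ratfun_valueI[of 1 z "[:0, 1:]"] by (simp add: ratfun_var_def to_fract_def)

lemma ratfun_value_0: "ratfun_value 0 z 0"
  using ratfun_valueI[of 1 z 0] by (simp add: Zero_fract_def)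

lemma ratfun_value_1: "ratfun_value 1 z 1"
  using ratfun_valueI[of 1 z 1] by (simp add: One_fract_def)

lemma ratfun_value_add:
  assumes "ratfun_value f z w" "ratfun_value g z u"
  shows "ratfun_value (f + g) z (w + u)"
proof -
  obtain p q where pq: "poly q z \<noteq> 0" "q \<noteq> 0" "f = Fract p q" "w = poly p z / poly q z"
    using assms(1) by (rule ratfun_valueE)
  obtain r s where rs: "poly s z \<noteq> 0" "s \<noteq> 0" "g = Fract r s" "u = poly r z / poly s z"
    using assms(2) by (rule ratfun_valueE)
  show ?thesis
    using ratfun_valueI[of "q * s" z "p * s + r * q"] pq rs by (simp add: add_frac_eq)
qed

lemma ratfun_value_mult:
  assumes "ratfun_value f z w" "ratfun_value g z u"
  shows "ratfun_value (f * g) z (w * u)"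
proof -
  obtain p q where pq: "poly q z \<noteq> 0" "q \<noteq> 0" "f = Fract p q" "w = poly p z / poly q z"
    using assms(1) by (rule ratfun_valueE)
  obtain r s where rs: "poly s z \<noteq> 0" "s \<noteq> 0" "g = Fract r s" "u = poly r z / poly s z"
    using assms(2) by (rule ratfun_valueE)
  show ?thesis
    using ratfun_valueI[of "q * s" z "p * r"] pq rs by simp
qed

lemma ratfun_value_minus:
  assumes "ratfun_value f z w"
  shows "ratfun_value (- f) z (- w)"
proof -
  obtain p q where pq: "poly q z \<noteq> 0" "q \<noteq> 0" "f = Fract p q" "w = poly p z / poly q z"
    using assms by (rule ratfun_valueE)
  show ?thesis
    using ratfun_valueI[of q z "- p"] pq by simp
qed

lemma ratfun_value_diff:
  assumes "ratfun_value f z w" "ratfun_value g z u"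
  shows "ratfun_value (f - g) z (w - u)"
  using ratfun_value_add[OF assms(1) ratfun_value_minus[OF assms(2)]] by simp

lemma ratfun_value_divide:
  assumes "ratfun_value f z w" "ratfun_value g z u" "u \<noteq> 0"
  shows "ratfun_value (f / g) z (w / u)"
proof -
  obtain p q where pq: "poly q z \<noteq> 0" "q \<noteq> 0" "f = Fract p q" "w = poly p z / poly q z"
    using assms(1) by (rule ratfun_valueE)
  obtain r s where rs: "poly s z \<noteq> 0" "s \<noteq> 0" "g = Fract r s" "u = poly r z / poly s z"
    using assms(2) by (rule ratfun_valueE)
  have "poly r z \<noteq> 0"
    using assms(3) rs by simp
  thus ?thesis
    using ratfun_valueI[of "q * r" z "p * s"] pq rs by simp
qed

lemma ratfun_value_sum:
  assumes "\<And>j. j \<in> S \<Longrightarrow> ratfun_value (f j) z (w j)"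
  shows "ratfun_value (\<Sum>j\<in>S. f j) z (\<Sum>j\<in>S. w j)"
  using assms
  by (induction S rule: infinite_finite_induct)
     (auto intro: ratfun_value_0 ratfun_value_add)

lemma T_matrix_entry_value:
  assumes "\<And>j. j \<in> {1..m} \<Longrightarrow> z \<noteq> \<alpha> j"
  shows "ratfun_value (T_matrix m B \<alpha> $ i $ k) z
    (- (B 0 $ i $ k) + mat 1 $ i $ k * z + (\<Sum>j = 1..m. B j $ i $ k / (z - \<alpha> j)))"
proof -
  have "ratfun_value (mat 1 $ i $ k) z (mat 1 $ i $ k)"
    by (auto simp: mat_def ratfun_value_0 ratfun_value_1)
  thus ?thesis
    unfolding T_matrix_def using assms
    by (auto intro!: ratfun_value_add ratfun_value_minus ratfun_value_mult ratfun_value_sum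
        ratfun_value_divide ratfun_value_diff ratfun_value_const ratfun_value_var)
qed

section \<open>Norms of complex vectors\<close>

lemma of_real_norm_sq_vec:
  fixes x :: "complex ^ 'n"
  shows "complex_of_real ((norm x)\<^sup>2) = (\<Sum>i\<in>UNIV. cnj (x $ i) * x $ i)"
  by (simp add: norm_vec_def L2_set_def sum_nonneg complex_norm_square mult.commute
      flip: of_real_power)

text \<open>The conjugate transpose is the adjoint for the standard Hermitian form.\<close>

lemma conj_transpose_adjoint:
  fixes A :: "complex ^ 'n ^ 'm"
  shows "(\<Sum>i\<in>UNIV. cnj ((A *v x) $ i) * y $ i)
       = (\<Sum>j\<in>UNIV. cnj (x $ j) * (conj_transpose A *v y) $ j)"
  unfolding matrix_vector_mult_def conj_transpose_def
  by (simp add: sum_distrib_left sum_distrib_right, subst sum.swap) (simp add: mult_ac)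

lemma norm_unitary_matrix_vector_mult:
  assumes "unitary_matrix U"
  shows "norm (U *v x) = norm x"
proof -
  have "conj_transpose U *v (U *v x) = x"
    using assms by (simp add: unitary_matrix_def matrix_vector_mul_assoc)
  hence "complex_of_real ((norm (U *v x))\<^sup>2) = complex_of_real ((norm x)\<^sup>2)"
    unfolding of_real_norm_sq_vec conj_transpose_adjoint by simp
  hence "(norm (U *v x))\<^sup>2 = (norm x)\<^sup>2"
    unfolding of_real_eq_iff .
  thus ?thesis
    by (simp add: power2_eq_iff_nonneg)
qed

lemma norm_vector_scalar_mult:
  fixes x :: "complex ^ 'n"
  shows "norm (c *s x) = cmod c * norm x"
  by (simp add: norm_vec_def norm_mult L2_set_right_distrib)

section \<open>The eigenvalue bound\<close>

text \<open>
  This is the triangle inequality for the eigenvalue equation solved for \<open>z v\<close>; each of the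
  \<open>B\<^sub>j v\<close> has the norm of \<open>v\<close>, which cancels.
\<close>

lemma eigenvalue_cmod_le:
  fixes B :: "nat \<Rightarrow> complex ^ 'n ^ 'n"
  assumes unitary: "\<And>j. j \<le> m \<Longrightarrow> unitary_matrix (B j)"
    and poles: "\<And>j. j \<in> {1..m} \<Longrightarrow> z \<noteq> \<alpha> j"
    and eigen: "ratmat_eigenvalue (T_matrix m B \<alpha>) z"
  shows "cmod z \<le> 1 + (\<Sum>j = 1..m. 1 / cmod (z - \<alpha> j))"
proof -
  obtain A v where A: "ratmat_value (T_matrix m B \<alpha>) z A" and v: "v \<noteq> 0" "A *v v = 0"
    using eigen unfolding ratmat_eigenvalue_def by blast
  have entry: "A $ i $ k = - (B 0 $ i $ k) + mat 1 $ i $ k * z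
      + (\<Sum>j = 1..m. B j $ i $ k / (z - \<alpha> j))" for i k
    using A unfolding ratmat_value_def
    by (intro ratfun_value_unique[OF _ T_matrix_entry_value]) (auto simp: poles)
  have "A *v v = - (B 0 *v v) + z *s v + (\<Sum>j = 1..m. (1 / (z - \<alpha> j)) *s (B j *v v))"
  proof (rule vec_eq_iff[THEN iffD2], rule allI)
    fix i
    have "(A *v v) $ i = (\<Sum>k\<in>UNIV. - (B 0 $ i $ k * v $ k)
        + (mat 1 $ i $ k * z) * v $ k + (\<Sum>j = 1..m. B j $ i $ k / (z - \<alpha> j) * v $ k))"
      by (simp add: matrix_vector_mult_def entry algebra_simps sum_distrib_left)
    also have "\<dots> = - (\<Sum>k\<in>UNIV. B 0 $ i $ k * v $ k) + (\<Sum>k\<in>UNIV. (mat 1 $ i $ k * z) * v $ k)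
        + (\<Sum>k\<in>UNIV. \<Sum>j = 1..m. B j $ i $ k / (z - \<alpha> j) * v $ k)"
      by (simp add: sum.distrib sum_subtractf)
    also have "(\<Sum>k\<in>UNIV. (mat 1 $ i $ k * z) * v $ k) = z * v $ i"
      by (simp add: mat_def if_distrib if_distribR cong: if_cong)
    also have "(\<Sum>k\<in>UNIV. \<Sum>j = 1..m. B j $ i $ k / (z - \<alpha> j) * v $ k)
        = (\<Sum>j = 1..m. (1 / (z - \<alpha> j)) * (\<Sum>k\<in>UNIV. B j $ i $ k * v $ k))"
      by (subst sum.swap) (simp add: sum_distrib_left)
    finally show "(A *v v) $ i
        = (- (B 0 *v v) + z *s v + (\<Sum>j = 1..m. (1 / (z - \<alpha> j)) *s (B j *v v))) $ i"
      by (simp add: matrix_vector_mult_def)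
  qed
  hence "z *s v = B 0 *v v - (\<Sum>j = 1..m. (1 / (z - \<alpha> j)) *s (B j *v v))"
    using v(2) by (simp add: algebra_simps add_eq_0_iff2)
  hence "cmod z * norm v = norm (B 0 *v v - (\<Sum>j = 1..m. (1 / (z - \<alpha> j)) *s (B j *v v)))"
    by (metis norm_vector_scalar_mult)
  also have "\<dots> \<le> norm (B 0 *v v) + (\<Sum>j = 1..m. norm ((1 / (z - \<alpha> j)) *s (B j *v v)))"
    by (intro order.trans[OF norm_triangle_ineq4] add_mono order_refl norm_sum)
  also have "\<dots> = (1 + (\<Sum>j = 1..m. 1 / cmod (z - \<alpha> j))) * norm v"
    by (simp add: norm_vector_scalar_mult norm_unitary_matrix_vector_mult unitary norm_divide
        ring_distribs sum_distrib_right)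
  finally show ?thesis
    using v(1) by simp
qed

text \<open>
  Completing the square bounds \<open>x\<close> by the positive root of \<open>x\<^sup>2 = x + c\<close>; the right-hand side is that
  root \<open>(1 + sqrt (4 c + 1)) / 2\<close>, written as the square root of its own square.
\<close>

lemma le_root_of_sq_le:
  fixes x c :: real
  assumes "c \<ge> 0" "x\<^sup>2 \<le> x + c"
  shows "x \<le> sqrt (((2 * c + 1) + sqrt (4 * c + 1)) / 2)"
proof -
  define s where "s = sqrt (4 * c + 1)"
  have s: "s \<ge> 0" "s\<^sup>2 = 4 * c + 1"
    using assms(1) by (simp_all add: s_def)
  have "(2 * x - 1)\<^sup>2 \<le> s\<^sup>2"
    using assms(2) s(2) by (simp add: power2_eq_square algebra_simps)
  hence "2 * x - 1 \<le> s"
    using s(1) by (rule power2_le_imp_le)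
  hence "x \<le> (1 + s) / 2"
    by simp
  also have "\<dots> = sqrt (((1 + s) / 2)\<^sup>2)"
    using s(1) by simp
  also have "((1 + s) / 2)\<^sup>2 = ((2 * c + 1) + s) / 2"
    using s(2) by (simp add: power2_eq_square field_simps)
  finally show ?thesis
    by (simp add: s_def)
qed

theorem theorem2p4:
  fixes m :: nat
    and B :: "nat \<Rightarrow> complex ^ 'n ^ 'n"
    and \<alpha> :: "nat \<Rightarrow> complex"
    and lambda0 :: complex
  assumes "m \<ge> 1"
    and "\<And>j. j \<le> m \<Longrightarrow> unitary_matrix (B j)"
    and "strict_mono_on {1..m} (\<lambda>j. cmod (\<alpha> j))"
    and "ratmat_eigenvalue (T_matrix m B \<alpha>) lambda0"
  shows "cmod lambda0 \<le>
           sqrt (((2 * real m + 1) + sqrt (4 * real m + 1)) / 2) + cmod (\<alpha> m)"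
proof (cases "cmod lambda0 \<le> cmod (\<alpha> m)")
  case True
  moreover have "0 \<le> sqrt (((2 * real m + 1) + sqrt (4 * real m + 1)) / 2)"
    by simp
  ultimately show ?thesis
    by linarith
next
  case False
  define x where "x = cmod lambda0 - cmod (\<alpha> m)"
  have x: "x > 0"
    using False by (simp add: x_def)
  have dist: "x \<le> cmod (lambda0 - \<alpha> j)" if j: "j \<in> {1..m}" for j
  proof -
    have "cmod (\<alpha> j) \<le> cmod (\<alpha> m)"
      using strict_mono_on_leD[OF assms(3)] j assms(1) by simp
    thus ?thesis
      using norm_triangle_ineq2[of lambda0 "\<alpha> j"] by (simp add: x_def)
  qed
  have "x \<le> cmod lambda0"
    by (simp add: x_def)
  also have "\<dots> \<le> 1 + (\<Sum>j = 1..m. 1 / cmod (lambda0 - \<alpha> j))"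
    using assms(2,4) dist x by (intro eigenvalue_cmod_le[where B = B]) force+
  also have "\<dots> \<le> 1 + (\<Sum>j = 1..m. 1 / x)"
    using dist x by (intro add_left_mono sum_mono frac_le) auto
  finally have "x * x \<le> (1 + real m / x) * x"
    using x by (intro mult_right_mono) auto
  hence "x\<^sup>2 \<le> x + real m"
    using x by (simp add: power2_eq_square algebra_simps)
  from le_root_of_sq_le[OF _ this] show ?thesis
    by (simp add: x_def)
qed

end
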